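(* Let $n\ge2$. Every facet of the classical profile region $\mathfrak C_n$ that admits a violation in $\mathfrak G_n$ (i.e. whose facet-defining inequality fails for some profile in $\mathfrak G_n$) also admits a violation in the quantum region $\mathfrak Q_n$, by a profile of $n$ quantum states on a Hilbert space of dimension at most three. More precisely: for $n\ge4$, the facets $\widehat c_{\{i\}}(D)\ge0$ of $\mathfrak C_n$ indexed by singletons are satisfied by all profiles in $\mathfrak G_n$, and every facet $\widehat c_B(D)\ge0$ indexed by a set $B\subseteq[n]$ with $|B|\ge2$ is violated by a quantum profile. For $n=3$, the facets indexed by singletons and by pairs are satisfied by all profiles in $\mathfrak G_3$, and the facet indexed by $\{1,2,3\}$ is violated by a quantum profile.
   Context: $[n]=\{1,\ldots,n\}$. A finite-dimensional GPT state space is a nonempty compact convex subset $K$ of some $\mathbb R^d$, $d\ge1$. A (finite-outcome) measurement on $K$ is a finite family $(e_x)_{x\in X}$ of nonnegative affine functions on $K$ with $\sum_{x}e_x=1$; every such family is allowed. For a list of (not necessarily distinct) states $s_1,\ldots,s_n\in K$ and nonempty $H\subseteq[n]$, the success profile is $D(H)=\max\sum_{i\in H}e_i(s_i)$, the maximum over all measurements $(e_i)_{i\in H}$ indexed by $H$, and the error profile is $F(H)=|H|-D(H)$; also $D(\varnothing)=F(\varnothing)=0$, and $D(\{i\})=1$ always. The profile regions are sets of vectors $(F(H))_{H\subseteq[n],|H|\ge2}\in\mathbb R^{2^n-n-1}$: $\mathfrak G_n$ consists of those arising from all finite-dimensional GPT state spaces $K$; $\mathfrak C_n$ of those arising from the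 probability simplexes $K=\Delta_m=\{p\in\mathbb R^m:p_j\ge0,\sum_jp_j=1\}$, $m\ge1$; $\mathfrak Q_n$ of those arising from $K=\mathcal D_d$, the density matrices in $M_d(\mathbb C)$, $d\ge1$ (measurements are then POVMs). A quantum profile is an element of $\mathfrak Q_n$; $d$ is the Hilbert-space dimension. The affine change of coordinates $D(H)=|H|-F(H)$ lets inequalities be stated in terms of $D$. For nonempty $B\subseteq[n]$, $\widehat c_B(D)=-\sum_{A\subseteq B}(-1)^{|B|-|A|}D([n]\setminus A)$. For $n\ge3$, the region $\mathfrak C_n$ is a full-dimensional polytope whose distinct facets are exactly those defined by the inequalities $\widehat c_B(D)\ge0$, $\varnothing\ne B\subseteq[n]$; the facet is said to be indexed by $B$. *)

theory Defs
  imports "HOL-Analysis.Analysis" "Jordan_Normal_Form.Schur_Decomposition"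
begin

no_notation vec_index (infixl "$" 100)
no_notation scalar_prod (infix "\<bullet>" 70)

text \<open>
  The index set $[n]$ is the universe of a finite type \<open>'n\<close> with \<open>CARD('n) = n\<close>.
  Dimensions of state spaces vary inside the definitions of the regions, so states are not
  drawn from a Euclidean space type: a point of $R^d$ is a function \<open>nat \<Rightarrow> real\<close> vanishing
  from index \<open>d\<close> on (as in \<^const>\<open>Euclidean_space\<close>), and a density matrix is a \<open>complex mat\<close>.
  The notions below therefore take the operation \<open>mix\<close> as a parameter, where
  \<open>mix t x y\<close> stands for the convex combination $(1-t)x + ty$.
\<close>

definition convex_wrt :: "(real \<Rightarrow> 's \<Rightarrow> 's \<Rightarrow> 's) \<Rightarrow> 's set \<Rightarrow> bool" where
  "convex_wrt mix K \<longleftrightarrow> (\<forall>x\<in>K. \<forall>y\<in>K. \<forall>t\<in>{0..1}. mix t x y \<in> K)"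

definition affine_fun :: "(real \<Rightarrow> 's \<Rightarrow> 's \<Rightarrow> 's) \<Rightarrow> 's set \<Rightarrow> ('s \<Rightarrow> real) \<Rightarrow> bool" where
  "affine_fun mix K e \<longleftrightarrow>
     (\<forall>x\<in>K. \<forall>y\<in>K. \<forall>t\<in>{0..1}. e (mix t x y) = (1 - t) * e x + t * e y)"

definition measurements ::
  "(real \<Rightarrow> 's \<Rightarrow> 's \<Rightarrow> 's) \<Rightarrow> 's set \<Rightarrow> 'n set \<Rightarrow> ('n \<Rightarrow> 's \<Rightarrow> real) set" where
  "measurements mix K H =
     {e. (\<forall>i\<in>H. affine_fun mix K (e i) \<and> (\<forall>x\<in>K. 0 \<le> e i x)) \<and> (\<forall>x\<in>K. (\<Sum>i\<in>H. e i x) = 1)}"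

text \<open>
  The success profile $D(H)$. For the state spaces below (finite-dimensional, compact, convex,
  nonempty) the set of values is compact and nonempty, so the supremum is the maximum.
\<close>

definition success ::
  "(real \<Rightarrow> 's \<Rightarrow> 's \<Rightarrow> 's) \<Rightarrow> 's set \<Rightarrow> ('n \<Rightarrow> 's) \<Rightarrow> 'n set \<Rightarrow> real" where
  "success mix K s H =
     (if H = {} then 0 else Sup ((\<lambda>e. \<Sum>i\<in>H. e i (s i)) ` measurements mix K H))"

text \<open>
  The vector $(F(H))_{|H|\ge 2}$, embedded in the space with one coordinate for every subset
  of $[n]$; the $n+1$ extra coordinates are \<open>0\<close>, which is the value of $F$ there.
\<close>

definition error_profile ::
  "(real \<Rightarrow> 's \<Rightarrow> 's \<Rightarrow> 's) \<Rightarrow> 's set \<Rightarrow> ('n \<Rightarrow> 's) \<Rightarrow> real^('n::finite set)" where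
  "error_profile mix K s =
     (\<chi> H. if 2 \<le> card H then real (card H) - success mix K s H else 0)"

definition profiles ::
  "(real \<Rightarrow> 's \<Rightarrow> 's \<Rightarrow> 's) \<Rightarrow> 's set \<Rightarrow> (real^('n::finite set)) set" where
  "profiles mix K = {error_profile mix K s | s. \<forall>i. s i \<in> K}"

definition vec_mix :: "real \<Rightarrow> (nat \<Rightarrow> real) \<Rightarrow> (nat \<Rightarrow> real) \<Rightarrow> nat \<Rightarrow> real" where
  "vec_mix t x y = (\<lambda>i. (1 - t) * x i + t * y i)"

definition mat_mix :: "real \<Rightarrow> complex mat \<Rightarrow> complex mat \<Rightarrow> complex mat" where
  "mat_mix t A B = complex_of_real (1 - t) \<cdot>\<^sub>m A + complex_of_real t \<cdot>\<^sub>m B"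

definition gpt_state_space :: "nat \<Rightarrow> (nat \<Rightarrow> real) set \<Rightarrow> bool" where
  "gpt_state_space d K \<longleftrightarrow> K \<noteq> {} \<and> compactin (Euclidean_space d) K \<and> convex_wrt vec_mix K"

definition prob_simplex :: "nat \<Rightarrow> (nat \<Rightarrow> real) set" where
  "prob_simplex m = {p. (\<forall>j. 0 \<le> p j) \<and> (\<forall>j\<ge>m. p j = 0) \<and> (\<Sum>j<m. p j) = 1}"

definition density_matrices :: "nat \<Rightarrow> complex mat set" where
  "density_matrices d =
     {A \<in> carrier_mat d d. mat_adjoint A = A \<and>
        (\<forall>v\<in>carrier_vec d. 0 \<le> Re ((A *\<^sub>v v) \<bullet>c v)) \<and> (\<Sum>i<d. A $$ (i, i)) = 1}"

definition gpt_region :: "(real^('n::finite set)) set" where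
  "gpt_region = (\<Union>d\<in>{1..}. \<Union>K\<in>{K. gpt_state_space d K}. profiles vec_mix K)"

definition classical_region :: "(real^('n::finite set)) set" where
  "classical_region = (\<Union>m\<in>{1..}. profiles vec_mix (prob_simplex m))"

text \<open>Profiles from Hilbert spaces of dimension \<open>d \<in> N\<close>; the region $Q_n$ is the case \<open>N = {1..}\<close>.\<close>

definition quantum_region :: "nat set \<Rightarrow> (real^('n::finite set)) set" where
  "quantum_region N = (\<Union>d\<in>N. profiles mat_mix (density_matrices d))"

text \<open>
  For a profile vector this is $D(H) = |H| - F(H)$ for all \<open>H\<close>, in particular
  \<open>0\<close> for \<open>H = {}\<close> and \<open>1\<close> for singletons, since the extra coordinates vanish.
\<close>

definition success_of :: "real^('n::finite set) \<Rightarrow> 'n set \<Rightarrow> real" where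
  "success_of F H = real (card H) - F $ H"

definition c_hat :: "'n::finite set \<Rightarrow> ('n set \<Rightarrow> real) \<Rightarrow> real" where
  "c_hat B D = - (\<Sum>A\<in>Pow B. (-1) ^ (card B - card A) * D (- A))"

text \<open>
  The inequality $a \cdot x \le b$ is valid on \<open>S\<close> and cuts out a facet of \<open>S\<close>. When it does, its
  restriction to the affine hull of \<open>S\<close> is determined by the facet up to a positive factor;
  all profile vectors lie in the subspace of vectors supported on \<open>{H. 2 \<le> card H}\<close>, in which
  \<^const>\<open>classical_region\<close> is full-dimensional.
\<close>

definition facet_inequality :: "'v::euclidean_space set \<Rightarrow> 'v \<Rightarrow> real \<Rightarrow> bool" where
  "facet_inequality S a b \<longleftrightarrow>
     (\<forall>x\<in>S. a \<bullet> x \<le> b) \<and> (S \<inter> {x. a \<bullet> x = b}) facet_of S"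

end

theory Submission
  imports Defs
begin

text \<open>
  A success profile depends only on the set of states used, so repeating a state inside or outside
  \<open>B\<close> collapses \<open>c_hat B\<close> to an alternating sum over the distinct states. It therefore suffices to
  find small configurations, and qubits suffice: \<open>D\<close> is one plus the radius of the smallest ball
  enclosing the Bloch vectors. Two antipodal pure states in \<open>B\<close> against two antipodal vectors of
  length 1/2 on an orthogonal axis outside \<open>B\<close> give the violations with two elements inside and two
  outside \<open>B\<close>; an almost equilateral triangle of pure states, with or without the maximally mixed
  state outside \<open>B\<close>, gives those with three elements in \<open>B\<close>.

  Classically, \<open>D H\<close> is a sum of maxima of nonnegative vectors, hence a nonnegative combination of
  the functions that indicate whether \<open>B\<close> meets \<open>H\<close>, with coefficients \<open>c_hat B D\<close>. So the classical
  region is cut out of its affine hull by \<open>c_hat B \<ge> 0\<close>, and it has a point at which all these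
  inequalities are strict; hence each facet inequality is a positive multiple of one of them.
\<close>

subsection \<open>Alternating sums and success probabilities\<close>

lemma sum_Pow_insert:
  fixes g :: "'a set \<Rightarrow> 'b::ab_group_add"
  assumes "finite B" "x \<notin> B"
  shows "(\<Sum>T\<in>Pow (insert x B). g T) = (\<Sum>T\<in>Pow B. g T) + (\<Sum>T\<in>Pow B. g (insert x T))"
proof -
  have "(\<Sum>T\<in>Pow (insert x B). g T) = sum g (Pow B) + sum g (insert x ` Pow B)"
    unfolding Pow_insert by (rule sum.union_disjoint) (use assms in auto)
  moreover have "inj_on (insert x) (Pow B)"
    using assms by (auto simp: inj_on_def)
  ultimately show ?thesis
    by (simp add: sum.reindex)
qed

lemma alternating_sum_Pow_insert:
  fixes g :: "'a set \<Rightarrow> real"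
  assumes "finite B" "x \<notin> B"
  shows "(\<Sum>T\<in>Pow (insert x B). (-1) ^ card T * g T) =
         (\<Sum>T\<in>Pow B. (-1) ^ card T * (g T - g (insert x T)))"
proof -
  have "(-1) ^ card (insert x T) * g (insert x T) = - ((-1) ^ card T * g (insert x T))" if "T \<in> Pow B" for T
    using that assms finite_subset[of T B] by (subst card_insert_disjoint) auto
  then show ?thesis
    using sum_Pow_insert[OF assms, of "\<lambda>T. (-1) ^ card T * g T"]
    by (simp add: sum_subtractf right_diff_distrib sum_negf)
qed

text \<open>For a fixed image \<open>S\<close>, the sets \<open>T\<close> choose a nonempty part of
  each fibre over \<open>S\<close>, and the signs of the nonempty parts of one fibre sum to
  -1.\<close>

lemma alternating_sum_Pow_image:
  fixes g :: "'b set \<Rightarrow> real"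
  assumes "finite B"
  shows "(\<Sum>T\<in>Pow B. (-1) ^ card T * g (f ` T)) = (\<Sum>S\<in>Pow (f ` B). (-1) ^ card S * g S)"
  using assms
proof (induction B arbitrary: g rule: finite_induct)
  case empty
  then show ?case by simp
next
  case (insert x B)
  let ?d = "\<lambda>S. g S - g (insert (f x) S)"
  have *: "(\<Sum>T\<in>Pow (insert x B). (-1) ^ card T * g (f ` T)) = (\<Sum>S\<in>Pow (f ` B). (-1) ^ card S * ?d S)"
    using alternating_sum_Pow_insert[OF insert.hyps, of "\<lambda>T. g (f ` T)"] insert.IH[of ?d] by simp
  show ?case
  proof (cases "f x \<in> f ` B")
    case False
    then show ?thesis
      using alternating_sum_Pow_insert[of "f ` B" "f x" g] insert.hyps * by simp
  next
    case True
    define L where "L = f ` B - {f x}"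
    have L: "finite L" "f x \<notin> L" "f ` B = insert (f x) L" "f ` insert x B = insert (f x) L"
      using True insert.hyps by (auto simp: L_def)
    \<comment> \<open>\<open>?d\<close> vanishes on sets that contain \<open>f x\<close>, so a
      repeated value changes nothing: both sums reduce to \<open>?d\<close> over
      \<open>Pow L\<close>.\<close>
    have "(\<Sum>S\<in>Pow (insert (f x) L). (-1) ^ card S * ?d S) = (\<Sum>S\<in>Pow L. (-1) ^ card S * ?d S)"
      by (subst alternating_sum_Pow_insert) (use L in auto)
    also have "\<dots> = (\<Sum>S\<in>Pow (insert (f x) L). (-1) ^ card S * g S)"
      by (subst alternating_sum_Pow_insert) (use L in auto)
    finally show ?thesis
      using * L by simp
  qed
qed

text \<open>Complementation inside \<open>B\<close> makes the states outside \<open>B\<close> a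
  fixed background to which \<open>T\<close> is added.\<close>

lemma c_hat_eq:
  "c_hat B D = - (\<Sum>T\<in>Pow B. (-1) ^ card T * D (- B \<union> T))"
proof -
  have "(\<Sum>A\<in>Pow B. (-1) ^ (card B - card A) * D (- A)) = (\<Sum>T\<in>Pow B. (-1) ^ card T * D (- B \<union> T))"
  proof (rule sum.reindex_bij_witness[where i = "\<lambda>T. B - T" and j = "\<lambda>T. B - T"])
    fix A assume "A \<in> Pow B"
    then have "- B \<union> (B - A) = - A" "card (B - A) = card B - card A"
      by (auto simp: card_Diff_subset finite_subset[of A B])
    then show "(-1) ^ card (B - A) * D (- B \<union> (B - A)) = (-1) ^ (card B - card A) * D (- A)"
      by simp
  qed auto
  then show ?thesis
    by (simp add: c_hat_def)
qed

section \<open>Effects, measurements and the success profile\<close>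

lemma affine_fun_const: "affine_fun mix K (\<lambda>x. c)"
  by (simp add: affine_fun_def algebra_simps)

lemma affine_fun_if:
  "affine_fun mix K (\<lambda>x. if P then f x else g x) \<longleftrightarrow> (if P then affine_fun mix K f else affine_fun mix K g)"
  by simp

lemma affine_fun_add:
  assumes "affine_fun mix K f" "affine_fun mix K g"
  shows "affine_fun mix K (\<lambda>x. f x + g x)"
  using assms by (auto simp: affine_fun_def algebra_simps)

lemma affine_fun_sum:
  assumes "\<And>i. i \<in> I \<Longrightarrow> affine_fun mix K (f i)"
  shows "affine_fun mix K (\<lambda>x. \<Sum>i\<in>I. f i x)"
  using assms by (induction I rule: infinite_finite_induct) (simp_all add: affine_fun_const affine_fun_add)

lemma measurements_nonneg:
  "e \<in> measurements mix K H \<Longrightarrow> i \<in> H \<Longrightarrow> x \<in> K \<Longrightarrow> 0 \<le> e i x"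
  by (simp add: measurements_def)

lemma measurements_affine:
  "e \<in> measurements mix K H \<Longrightarrow> i \<in> H \<Longrightarrow> affine_fun mix K (e i)"
  by (simp add: measurements_def)

lemma measurements_sum:
  "e \<in> measurements mix K H \<Longrightarrow> x \<in> K \<Longrightarrow> (\<Sum>i\<in>H. e i x) = 1"
  by (simp add: measurements_def)

lemma measurements_le_1:
  assumes "e \<in> measurements mix K H" "finite H" "i \<in> H" "x \<in> K"
  shows "e i x \<le> 1"
  using member_le_sum[of i H "\<lambda>i. e i x"] assms
  by (simp add: measurements_sum measurements_nonneg)

lemma measurements_nonempty:
  assumes "finite H" "H \<noteq> {}"
  shows "measurements mix K H \<noteq> {}"
proof -
  obtain j where "j \<in> H" using assms by auto
  then have "(\<lambda>i x. if i = j then 1 else 0) \<in> measurements mix K H"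
    using assms by (simp add: measurements_def affine_fun_const)
  then show ?thesis by blast
qed

lemma success_ge:
  assumes "e \<in> measurements mix K H" "finite H" "H \<noteq> {}" "\<And>i. i \<in> H \<Longrightarrow> s i \<in> K"
  shows "(\<Sum>i\<in>H. e i (s i)) \<le> success mix K s H"
proof -
  \<comment> \<open>\<open>Sup\<close> dominates its elements only on bounded sets; effects are at
    most 1, so \<open>card H\<close> is a bound.\<close>
  have "bdd_above ((\<lambda>e. \<Sum>i\<in>H. e i (s i)) ` measurements mix K H)"
    using assms by (intro bdd_aboveI2[where M = "\<Sum>i\<in>H. 1"] sum_mono measurements_le_1) auto
  then show ?thesis
    using assms by (auto simp: success_def intro: cSup_upper)
qed

lemma success_le:
  assumes "finite H" "H \<noteq> {}"
    and "\<And>e. e \<in> measurements mix K H \<Longrightarrow> (\<Sum>i\<in>H. e i (s i)) \<le> c"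
  shows "success mix K s H \<le> c"
  unfolding success_def
  using cSUP_least[OF measurements_nonempty[OF assms(1,2), of mix K] assms(3)] assms(2) by simp

lemma success_singleton:
  assumes "s i \<in> K"
  shows "success mix K s {i} = 1"
proof (rule antisym)
  show "success mix K s {i} \<le> 1"
    using assms measurements_sum[of _ mix K "{i}"] by (intro success_le) force+
  have "(\<lambda>i x. 1) \<in> measurements mix K {i}"
    by (simp add: measurements_def affine_fun_const)
  from success_ge[OF this, of s] show "1 \<le> success mix K s {i}"
    using assms by simp
qed

lemma success_of_error_profile:
  fixes s :: "'n::finite \<Rightarrow> 's"
  assumes "\<And>i. s i \<in> K"
  shows "success_of (error_profile mix K s) = success mix K s"
proof
  fix H :: "'n set"
  show "success_of (error_profile mix K s) H = success mix K s H"
  proof (cases "2 \<le> card H")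
    case False
    \<comment> \<open>The zero coordinates turn \<open>card H\<close> itself into the success value:
      0 for the empty set and 1 for singletons.\<close>
    then have "card H = 0 \<or> card H = 1" by linarith
    then have "H = {} \<or> (\<exists>i. H = {i})"
      by (metis card_0_eq card_1_singletonE finite)
    then show ?thesis
      using assms by (auto simp: success_of_def error_profile_def success_singleton success_def[of mix K s "{}"])
  qed (simp add: success_of_def error_profile_def)
qed

lemma success_mono:
  assumes "finite H'" "H \<subseteq> H'" "H \<noteq> {}" "\<And>i. i \<in> H' \<Longrightarrow> s i \<in> K"
  shows "success mix K s H \<le> success mix K s H'"
proof (rule success_le)
  fix e assume e: "e \<in> measurements mix K H"
  \<comment> \<open>The outcomes outside \<open>H\<close> get the zero effect.\<close>
  let ?e = "\<lambda>i x. if i \<in> H then e i x else 0"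
  have sum: "(\<Sum>i\<in>H'. ?e i (y i)) = (\<Sum>i\<in>H. e i (y i))" for y
    using assms by (intro sum.mono_neutral_cong_right) auto
  have "?e \<in> measurements mix K H'"
    using e sum by (simp add: measurements_def affine_fun_if affine_fun_const)
  from success_ge[OF this, of s] show "(\<Sum>i\<in>H. e i (s i)) \<le> success mix K s H'"
    using assms sum[of s] by auto
qed (use assms finite_subset in auto)

text \<open>
  Dual feasibility: each \<open>s i\<close> occurs with weight \<open>1 / c\<close> in a decomposition of one common
  state \<open>\<sigma>\<close>, so \<open>e i (s i) \<le> c * e i \<sigma>\<close>, and the values \<open>e i \<sigma>\<close> sum to 1.
\<close>

lemma success_le_dual:
  assumes "finite H" "H \<noteq> {}" "1 \<le> c" "\<sigma> \<in> K" "\<And>i. i \<in> H \<Longrightarrow> s i \<in> K"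
    and decomp: "\<And>i. i \<in> H \<Longrightarrow> \<exists>\<tau>\<in>K. mix (1 / c) \<tau> (s i) = \<sigma>"
  shows "success mix K s H \<le> c"
proof (rule success_le)
  fix e assume e: "e \<in> measurements mix K H"
  have "e i (s i) \<le> c * e i \<sigma>" if i: "i \<in> H" for i
  proof -
    obtain \<tau> where \<tau>: "\<tau> \<in> K" "mix (1 / c) \<tau> (s i) = \<sigma>"
      using decomp[OF i] by blast
    have "1 / c \<in> {0..1}"
      using assms(3) by simp
    then have "e i (mix (1 / c) \<tau> (s i)) = (1 - 1 / c) * e i \<tau> + 1 / c * e i (s i)"
      using measurements_affine[OF e i] \<tau>(1) assms(5)[OF i] unfolding affine_fun_def by blast
    then have "e i \<sigma> = (1 - 1 / c) * e i \<tau> + 1 / c * e i (s i)"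
      using \<tau>(2) by simp
    moreover have "0 \<le> (1 - 1 / c) * e i \<tau>"
      using measurements_nonneg[OF e i \<tau>(1)] assms(3) by (intro mult_nonneg_nonneg) auto
    ultimately have "e i (s i) / c \<le> e i \<sigma>"
      by simp
    then show ?thesis
      using assms(3) by (simp add: field_simps)
  qed
  then have "(\<Sum>i\<in>H. e i (s i)) \<le> (\<Sum>i\<in>H. c * e i \<sigma>)"
    by (rule sum_mono)
  also have "\<dots> = c"
    using measurements_sum[OF e assms(4)] by (simp flip: sum_distrib_left)
  finally show "(\<Sum>i\<in>H. e i (s i)) \<le> c" .
qed (use assms in auto)

text \<open>With \<open>id\<close> as labelling a state is its own index. The effect
  \<open>f\<close> announces \<open>P\<close>, its complement \<open>Q\<close>, and no other state
  is ever guessed.\<close>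

lemma success_ge_two_outcome:
  assumes "finite S" "S \<subseteq> K" "P \<in> S" "Q \<in> S" "P \<noteq> Q"
    and "affine_fun mix K f" "\<And>x. x \<in> K \<Longrightarrow> 0 \<le> f x \<and> f x \<le> 1"
  shows "f P + 1 - f Q \<le> success mix K id S"
proof -
  let ?e = "\<lambda>M x. if M = P then f x else if M = Q then 1 - f x else 0"
  have sum: "(\<Sum>M\<in>S. ?e M (y M)) = f (y P) + 1 - f (y Q)" for y
  proof -
    have "(\<Sum>M\<in>S. ?e M (y M)) = (\<Sum>M\<in>{P, Q}. ?e M (y M))"
      using assms by (intro sum.mono_neutral_right) auto
    then show ?thesis
      using \<open>P \<noteq> Q\<close> by simp
  qed
  have "affine_fun mix K (\<lambda>x. 1 - f x)"
    using assms(6) by (auto simp: affine_fun_def algebra_simps)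
  then have "?e \<in> measurements mix K S"
    using assms sum by (simp add: measurements_def affine_fun_if affine_fun_const)
  from success_ge[OF this, of id] show ?thesis
    using assms sum[of id] by auto
qed

text \<open>Effects of indices with equal states can be added into one. Conversely, a measurement
  for the distinct states serves one chosen index per state, and the remaining indices are restored
  by \<open>success_mono\<close>.\<close>

lemma success_image:
  assumes "finite H" "\<And>i. i \<in> H \<Longrightarrow> s i \<in> K"
  shows "success mix K s H = success mix K id (s ` H)"
proof (cases "H = {}")
  case True
  then show ?thesis by (simp add: success_def)
next
  case False
  show ?thesis
  proof (rule antisym)
    show "success mix K s H \<le> success mix K id (s ` H)"
    proof (rule success_le)
      fix e assume e: "e \<in> measurements mix K H"
      let ?e = "\<lambda>y x. \<Sum>i\<in>{i\<in>H. s i = y}. e i x"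
      have "(\<Sum>y\<in>s ` H. ?e y x) = (\<Sum>i\<in>H. e i x)" for x
        using assms(1) by (intro sum.group) auto
      then have "?e \<in> measurements mix K (s ` H)"
        using e by (auto simp: measurements_def intro!: affine_fun_sum sum_nonneg)
      then have "(\<Sum>y\<in>s ` H. ?e y (id y)) \<le> success mix K id (s ` H)"
        using assms False by (intro success_ge) auto
      moreover have "(\<Sum>y\<in>s ` H. ?e y (id y)) = (\<Sum>y\<in>s ` H. \<Sum>i\<in>{i\<in>H. s i = y}. e i (s i))"
        by (intro sum.cong) auto
      moreover have "\<dots> = (\<Sum>i\<in>H. e i (s i))"
        using assms(1) by (intro sum.group) auto
      ultimately show "(\<Sum>i\<in>H. e i (s i)) \<le> success mix K id (s ` H)"
        by simp
    qed (use assms False in auto)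
  next
    show "success mix K id (s ` H) \<le> success mix K s H"
    proof (rule success_le)
      fix e assume e: "e \<in> measurements mix K (s ` H)"
      obtain R where R: "R \<subseteq> H" "inj_on s R" "s ` R = s ` H"
        by (metis subset_image_inj order_refl)
      have R': "finite R" "R \<noteq> {}"
        using finite_subset[OF R(1) assms(1)] R(3) False by (fast, blast)
      have "(\<lambda>i. e (s i)) \<in> measurements mix K R"
        using e R(2) unfolding R(3)[symmetric] by (auto simp: measurements_def sum.reindex)
      then have "(\<Sum>i\<in>R. e (s i) (s i)) \<le> success mix K s R"
        using assms(2) R(1) R' by (intro success_ge) auto
      also have "\<dots> \<le> success mix K s H"
        using assms R(1) R' by (intro success_mono) auto
      finally show "(\<Sum>y\<in>s ` H. e y (id y)) \<le> success mix K s H"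
        unfolding R(3)[symmetric] using R(2) by (simp add: sum.reindex)
    qed (use assms False in auto)
  qed
qed

text \<open>Only the sets of states used inside and outside \<open>B\<close> matter, so a violation
  found with few states can be spread over larger index sets.\<close>

lemma c_hat_success_image:
  fixes s :: "'n::finite \<Rightarrow> 's"
  assumes "\<And>i. s i \<in> K"
  shows "c_hat B (success mix K s) =
    - (\<Sum>S\<in>Pow (s ` B). (-1) ^ card S * success mix K id (s ` (- B) \<union> S))"
  using alternating_sum_Pow_image[of B "\<lambda>S. success mix K id (s ` (- B) \<union> S)" s] assms
  by (simp add: c_hat_eq success_image[of _ s K] image_Un)

subsection \<open>Qubits\<close>

text \<open>Multiplication by \<open>a\<close> allows completing the square; \<open>a = 0\<close>
  forces \<open>x = 0\<close>.\<close>

lemma real_quadratic_form_nonneg: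
  fixes a d x p r :: real
  assumes "0 \<le> a" "0 \<le> d" "x\<^sup>2 \<le> a * d"
  shows "0 \<le> a * p\<^sup>2 + d * r\<^sup>2 + 2 * x * (p * r)"
proof (cases "a = 0")
  case True
  then show ?thesis
    using assms by simp
next
  case False
  have "a * (a * p\<^sup>2 + d * r\<^sup>2 + 2 * x * (p * r)) = (a * p + x * r)\<^sup>2 + (a * d - x\<^sup>2) * r\<^sup>2"
    by (simp add: power2_eq_square algebra_simps)
  also have "\<dots> \<ge> 0"
    using assms by simp
  finally show ?thesis
    using False assms(1) by (simp add: zero_le_mult_iff)
qed

text \<open>The matrix (I + x X + z Z) / 2 with Pauli matrices X and Z. A plane section of the Bloch
  ball suffices, so the third Bloch coordinate is zero.\<close>

definition qubit :: "real \<Rightarrow> real \<Rightarrow> complex mat" where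
  "qubit x z = mat 2 2 (\<lambda>(i, j). complex_of_real (if i = j then (if i = 0 then 1 + z else 1 - z) / 2 else x / 2))"

definition bloch_x :: "complex mat \<Rightarrow> real" where
  "bloch_x A = 2 * Re (A $$ (0, 1))"

definition bloch_z :: "complex mat \<Rightarrow> real" where
  "bloch_z A = Re (A $$ (0, 0)) - Re (A $$ (1, 1))"

lemma bloch_qubit [simp]:
  "bloch_x (qubit x z) = x" "bloch_z (qubit x z) = z"
  by (simp_all add: bloch_x_def bloch_z_def qubit_def field_simps)

lemma qubit_inject [simp]: "qubit x z = qubit x' z' \<longleftrightarrow> x = x' \<and> z = z'"
  by (metis bloch_qubit)

lemma mat_mix_qubit:
  "mat_mix t (qubit x z) (qubit x' z') = qubit ((1 - t) * x + t * x') ((1 - t) * z + t * z')"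
  by (rule eq_matI) (auto simp: mat_mix_def qubit_def field_simps)

lemma inner_mult_mat_vec_2:
  fixes A :: "complex mat"
  assumes "A \<in> carrier_mat 2 2" "v \<in> carrier_vec 2"
  shows "(A *\<^sub>v v) \<bullet>c v =
    (A $$ (0,0) * vec_index v 0 + A $$ (0,1) * vec_index v 1) * cnj (vec_index v 0) +
    (A $$ (1,0) * vec_index v 0 + A $$ (1,1) * vec_index v 1) * cnj (vec_index v 1)"
  using assms by (simp add: scalar_prod_def numeral_2_eq_2)

lemma qubit_density:
  assumes "x\<^sup>2 + z\<^sup>2 \<le> 1"
  shows "qubit x z \<in> density_matrices 2"
proof -
  have carrier: "qubit x z \<in> carrier_mat 2 2"
    by (simp add: qubit_def)
  have adj: "mat_adjoint (qubit x z) = qubit x z"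
    by (rule eq_matI) (auto simp: mat_adjoint_def qubit_def mat_of_rows_def)
  have tr: "(\<Sum>i<2. qubit x z $$ (i, i)) = 1"
    by (simp add: qubit_def numeral_2_eq_2 field_simps)
  have "z\<^sup>2 \<le> 1"
    using assms zero_le_power2[of x] by linarith
  then have "\<bar>z\<bar> \<le> 1"
    by (simp add: abs_square_le_1)
  then have q: "0 \<le> (1 + z) / 2" "0 \<le> (1 - z) / 2" "(x / 2)\<^sup>2 \<le> (1 + z) / 2 * ((1 - z) / 2)"
    using assms by (auto simp: power2_eq_square field_simps)
  have "0 \<le> Re ((qubit x z *\<^sub>v v) \<bullet>c v)" if v: "v \<in> carrier_vec 2" for v
  proof -
    define p q r s where "p = Re (vec_index v 0)" "q = Im (vec_index v 0)"
      "r = Re (vec_index v 1)" "s = Im (vec_index v 1)"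
    \<comment> \<open>A real symmetric matrix acts separately on the real and imaginary parts of
      \<open>v\<close>, so the form is a sum of two real quadratic forms.\<close>
    have "Re ((qubit x z *\<^sub>v v) \<bullet>c v) =
        ((1 + z) / 2 * p\<^sup>2 + (1 - z) / 2 * r\<^sup>2 + 2 * (x / 2) * (p * r)) +
        ((1 + z) / 2 * q\<^sup>2 + (1 - z) / 2 * s\<^sup>2 + 2 * (x / 2) * (q * s))"
      unfolding inner_mult_mat_vec_2[OF carrier v]
      by (simp add: qubit_def p_q_r_s_def power2_eq_square field_simps)
    also have "\<dots> \<ge> 0"
      by (intro add_nonneg_nonneg[OF real_quadratic_form_nonneg[OF q] real_quadratic_form_nonneg[OF q]])
    finally show ?thesis .
  qed
  then show ?thesis
    using carrier adj tr by (simp add: density_matrices_def)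
qed

text \<open>Positivity on real vectors already yields \<open>x\<^sup>2 \<le> a * d\<close>; with
  trace 1 this confines the two Bloch coordinates to the unit disc.\<close>

lemma bloch_ball:
  assumes "A \<in> density_matrices 2"
  shows "(bloch_x A)\<^sup>2 + (bloch_z A)\<^sup>2 \<le> 1"
proof -
  define a d x where "a = Re (A $$ (0,0))" "d = Re (A $$ (1,1))" "x = Re (A $$ (0,1))"
  have A: "A \<in> carrier_mat 2 2" "mat_adjoint A = A"
    and pos: "\<And>v. v \<in> carrier_vec 2 \<Longrightarrow> 0 \<le> Re ((A *\<^sub>v v) \<bullet>c v)"
    and tr: "(\<Sum>i<2. A $$ (i, i)) = 1"
    using assms by (auto simp: density_matrices_def)
  have "Re (A $$ (0,0) + A $$ (1,1)) = 1"
    using tr by (simp add: numeral_2_eq_2)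
  then have ad: "a + d = 1"
    by (simp add: a_d_x_def)
  have "A $$ (1, 0) = cnj (A $$ (0, 1))"
    using A(1) arg_cong[OF A(2), of "\<lambda>M. M $$ (1, 0)"]
    by (simp add: mat_adjoint_def mat_of_rows_def)
  then have x: "Re (A $$ (1, 0)) = x"
    by (simp add: a_d_x_def)
  have q: "0 \<le> p\<^sup>2 * a + r\<^sup>2 * d + 2 * p * r * x" for p r :: real
  proof -
    define v where "v = vec 2 (\<lambda>i. complex_of_real (if i = 0 then p else r))"
    have v: "v \<in> carrier_vec 2" "vec_index v 0 = of_real p" "vec_index v 1 = of_real r"
      by (simp_all add: v_def)
    have "Re ((A *\<^sub>v v) \<bullet>c v) = p\<^sup>2 * a + r\<^sup>2 * d + 2 * p * r * x"
      unfolding inner_mult_mat_vec_2[OF A(1) v(1)] v(2,3)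
      using x by (simp add: a_d_x_def power2_eq_square algebra_simps)
    then show ?thesis
      using pos[OF v(1)] by simp
  qed
  have "x\<^sup>2 \<le> a * d"
  proof (cases "a = 0")
    case True
    \<comment> \<open>With \<open>a = 0\<close> and \<open>d = 1\<close>, the vector (-1, x) gives
      the form the value -x^2.\<close>
    then show ?thesis
      using q[of "-1" x] ad by (simp add: power2_eq_square)
  next
    case False
    then have "0 < a"
      using q[of 1 0] by simp
    \<comment> \<open>The vector (x, -a) is orthogonal to the real first row (a, x).\<close>
    moreover have "0 \<le> a * (a * d - x\<^sup>2)"
      using q[of x "- a"] by (simp add: power2_eq_square algebra_simps)
    ultimately show ?thesis
      by (simp add: zero_le_mult_iff)
  qed
  then have "(2 * x)\<^sup>2 + (a - d)\<^sup>2 \<le> (a + d)\<^sup>2"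
    by (simp add: power2_eq_square algebra_simps)
  then show ?thesis
    using ad by (simp add: bloch_x_def bloch_z_def a_d_x_def)
qed

lemma affine_fun_bloch:
  "affine_fun mat_mix (density_matrices 2) (\<lambda>A. w + u * bloch_x A + v * bloch_z A)"
  unfolding affine_fun_def
proof (intro ballI)
  fix A B :: "complex mat" and t :: real
  assume "A \<in> density_matrices 2" "B \<in> density_matrices 2"
  then have *: "A \<in> carrier_mat 2 2" "B \<in> carrier_mat 2 2"
    by (simp_all add: density_matrices_def)
  have "bloch_x (mat_mix t A B) = (1 - t) * bloch_x A + t * bloch_x B"
    "bloch_z (mat_mix t A B) = (1 - t) * bloch_z A + t * bloch_z B"
    using * by (simp_all add: mat_mix_def bloch_x_def bloch_z_def right_diff_distrib)
  then show "w + u * bloch_x (mat_mix t A B) + v * bloch_z (mat_mix t A B) =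
      (1 - t) * (w + u * bloch_x A + v * bloch_z A) + t * (w + u * bloch_x B + v * bloch_z B)"
    by (simp only:) (simp add: algebra_simps)
qed

abbreviation qubit_success :: "complex mat set \<Rightarrow> real" where
  "qubit_success \<equiv> success mat_mix (density_matrices 2) id"

text \<open>The optimal two-outcome measurement of Helstrom, along the Bloch direction \<open>(u, v)\<close>.\<close>

lemma qubit_success_ge:
  assumes "finite S" "S \<subseteq> density_matrices 2" "qubit x z \<in> S" "qubit x' z' \<in> S"
    and "(x, z) \<noteq> (x', z')" "u\<^sup>2 + v\<^sup>2 = 1"
  shows "1 + (u * (x - x') + v * (z - z')) / 2 \<le> qubit_success S"
proof -
  let ?f = "\<lambda>A. 1/2 + u/2 * bloch_x A + v/2 * bloch_z A"
  have "0 \<le> ?f A \<and> ?f A \<le> 1" if A: "A \<in> density_matrices 2" for A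
  proof -
    \<comment> \<open>The added square is the defect in the Cauchy-Schwarz inequality.\<close>
    have "(u * bloch_x A + v * bloch_z A)\<^sup>2
        \<le> (u * bloch_x A + v * bloch_z A)\<^sup>2 + (u * bloch_z A - v * bloch_x A)\<^sup>2"
      by simp
    also have "\<dots> = (u\<^sup>2 + v\<^sup>2) * ((bloch_x A)\<^sup>2 + (bloch_z A)\<^sup>2)"
      by (simp add: power2_eq_square algebra_simps)
    also have "\<dots> \<le> 1"
      using bloch_ball[OF A] assms(6) by simp
    finally have "(u * bloch_x A + v * bloch_z A)\<^sup>2 \<le> 1" .
    then have "\<bar>u * bloch_x A + v * bloch_z A\<bar> \<le> 1"
      by (simp add: abs_square_le_1)
    then show ?thesis
      by (simp add: abs_le_iff)
  qed
  then have "?f (qubit x z) + 1 - ?f (qubit x' z') \<le> qubit_success S"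
    by (intro success_ge_two_outcome[OF assms(1-4) _ affine_fun_bloch]) (use assms(5) in simp_all)
  then show ?thesis
    by (simp add: right_diff_distrib diff_divide_distrib add_divide_distrib)
qed

text \<open>
  The ball with centre \<open>(k, l)\<close> and radius \<open>r\<close> encloses the Bloch vectors of the states; the common
  state \<open>\<sigma>\<close> of the dual bound has Bloch vector \<open>(k, l) / (1 + r)\<close>.
\<close>

lemma qubit_success_le:
  assumes "finite S" "S \<noteq> {}" "S \<subseteq> density_matrices 2" "0 < r" "k\<^sup>2 + l\<^sup>2 \<le> (1 + r)\<^sup>2"
    and ball: "\<forall>A\<in>S. A = qubit (bloch_x A) (bloch_z A) \<and> (k - bloch_x A)\<^sup>2 + (l - bloch_z A)\<^sup>2 \<le> r\<^sup>2"
  shows "qubit_success S \<le> 1 + r"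
proof (rule success_le_dual[where \<sigma> = "qubit (k / (1 + r)) (l / (1 + r))"])
  fix A assume "A \<in> S"
  note A = ball[rule_format, OF this]
  \<comment> \<open>The complementary state points from \<open>A\<close> to the centre, scaled by 1
    / r into the unit disc. With weights r / (1 + r) and 1 / (1 + r) the vector of \<open>A\<close>
    cancels.\<close>
  let ?x = "(k - bloch_x A) / r" and ?z = "(l - bloch_z A) / r"
  have "?x\<^sup>2 + ?z\<^sup>2 = ((k - bloch_x A)\<^sup>2 + (l - bloch_z A)\<^sup>2) / r\<^sup>2"
    by (simp add: power_divide add_divide_distrib)
  also have "\<dots> \<le> 1"
    using A assms(4) by simp
  finally have "qubit ?x ?z \<in> density_matrices 2"
    by (rule qubit_density)
  moreover have "(1 - 1 / (1 + r)) * ((y - y') / r) + 1 / (1 + r) * y' = y / (1 + r)" for y y'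
  proof -
    have "1 - 1 / (1 + r) = r / (1 + r)"
      using assms(4) by (simp add: field_simps)
    then have "(1 - 1 / (1 + r)) * ((y - y') / r) = (y - y') / (1 + r)"
      using assms(4) by simp
    then show ?thesis
      by (simp add: diff_divide_distrib)
  qed
  then have "mat_mix (1 / (1 + r)) (qubit ?x ?z) (qubit (bloch_x A) (bloch_z A)) =
      qubit (k / (1 + r)) (l / (1 + r))"
    by (simp only: mat_mix_qubit)
  ultimately show "\<exists>\<tau>\<in>density_matrices 2. mat_mix (1 / (1 + r)) \<tau> (id A) = qubit (k / (1 + r)) (l / (1 + r))"
    using A by (metis id_apply)
next
  have "(k / (1 + r))\<^sup>2 + (l / (1 + r))\<^sup>2 = (k\<^sup>2 + l\<^sup>2) / (1 + r)\<^sup>2"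
    by (simp add: power_divide add_divide_distrib)
  also have "\<dots> \<le> 1"
    using assms(4,5) by simp
  finally show "qubit (k / (1 + r)) (l / (1 + r)) \<in> density_matrices 2"
    by (rule qubit_density)
qed (use assms(1-4) in \<open>simp_all add: subset_iff\<close>)

section \<open>Violations by small qubit configurations\<close>

lemma exists_image_eq:
  assumes "finite X" "finite B" "card X \<le> card B" "X = {} \<longleftrightarrow> B = {}"
  shows "\<exists>f. f ` B = X"
proof (cases "X = {}")
  case False
  then show ?thesis
    using card_le_inj[OF assms(1-3)] inj_on_iff_surj[of X B] by blast
qed (use assms(4) in auto)

text \<open>\<open>X\<close> is spread over \<open>B\<close> and \<open>Y\<close> over its
  complement, with repetitions; the sum in \<open>pos\<close> is then minus
  \<open>c_hat B\<close>.\<close>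

lemma quantum_violationI:
  fixes B :: "'n::finite set"
  assumes X: "finite X" "X \<subseteq> density_matrices 2" "X \<noteq> {}" "card X \<le> card B"
    and Y: "finite Y" "Y \<subseteq> density_matrices 2" "Y = {} \<longleftrightarrow> - B = {}" "card Y \<le> card (- B)"
    and pos: "0 < (\<Sum>S\<in>Pow X. (-1) ^ card S * qubit_success (Y \<union> S))"
  shows "\<exists>F\<in>quantum_region {1..3}. c_hat B (success_of F) < 0"
proof -
  have "B \<noteq> {}"
    using X by auto
  then obtain f where f: "f ` B = X"
    using exists_image_eq[of X B] X by auto
  obtain h where h: "h ` (- B) = Y"
    using exists_image_eq[of Y "- B"] Y by auto
  define s where "s i = (if i \<in> B then f i else h i)" for i
  have s: "s ` B = X" "s ` (- B) = Y"
    using f h by (auto simp: s_def)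
  have sK: "s i \<in> density_matrices 2" for i
  proof (cases "i \<in> B")
    case True
    then show ?thesis using s(1) X(2) by blast
  next
    case False
    then show ?thesis using s(2) Y(2) by blast
  qed
  have "error_profile mat_mix (density_matrices 2) s \<in> quantum_region {1..3}"
    unfolding quantum_region_def profiles_def using sK by force
  moreover have "c_hat B (success_of (error_profile mat_mix (density_matrices 2) s)) < 0"
    using pos by (simp add: success_of_error_profile sK c_hat_success_image[of s, OF sK] s)
  ultimately show ?thesis
    by blast
qed

text \<open>The alternating sum is at least 3/2 - 13/8 - 13/8 + 2 = 1/4.\<close>

lemma quantum_violation_pairs:
  fixes B :: "'n::finite set"
  assumes "2 \<le> card B" "2 \<le> card (- B)"
  shows "\<exists>F\<in>quantum_region {1..3}. c_hat B (success_of F) < 0"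
proof -
  define P Q U V where "P = qubit 0 1" "Q = qubit 0 (-1)" "U = qubit (1/2) 0" "V = qubit (-1/2) 0"
  note defs = this
  have dens: "P \<in> density_matrices 2" "Q \<in> density_matrices 2" "U \<in> density_matrices 2" "V \<in> density_matrices 2"
    by (auto simp: defs power2_eq_square intro!: qubit_density)
  have neq: "P \<noteq> Q" "U \<noteq> V"
    by (simp_all add: defs)
  have UV: "3 / 2 \<le> qubit_success {U, V}"
    using qubit_success_ge[of "{U, V}" "1/2" 0 "-1/2" 0 1 0] dens by (simp add: defs)
  have UVPQ: "2 \<le> qubit_success {U, V, P, Q}"
    using qubit_success_ge[of "{U, V, P, Q}" 0 1 0 "-1" 0 1] dens by (simp add: defs)
  \<comment> \<open>The circle through \<open>P\<close>, \<open>U\<close> and \<open>V\<close> has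
    centre (0, 3/8) and radius 5/8; its reflection passes through \<open>Q\<close>.\<close>
  have UVP: "qubit_success {U, V, P} \<le> 13 / 8"
    using qubit_success_le[of "{U, V, P}" "5/8" 0 "3/8"] dens by (simp add: defs power2_eq_square)
  have UVQ: "qubit_success {U, V, Q} \<le> 13 / 8"
    using qubit_success_le[of "{U, V, Q}" "5/8" 0 "-3/8"] dens by (simp add: defs power2_eq_square)
  show ?thesis
  proof (rule quantum_violationI[of "{P, Q}" B "{U, V}"])
    show "0 < (\<Sum>S\<in>Pow {P, Q}. (-1) ^ card S * qubit_success ({U, V} \<union> S))"
      using neq UV UVPQ UVP UVQ by (simp add: alternating_sum_Pow_insert)
  qed (use assms dens neq in auto)
qed

lemma quantum_violation_triple:
  fixes B :: "'n::finite set"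
  assumes "3 \<le> card B"
  shows "\<exists>F\<in>quantum_region {1..3}. c_hat B (success_of F) < 0"
proof -
  \<comment> \<open>Points with coordinates from the triple 3, 4, 5 stay rational while being close
    enough to an equilateral triangle.\<close>
  define P Q R C where "P = qubit 0 1" "Q = qubit (4/5) (-3/5)" "R = qubit (-4/5) (-3/5)" "C = qubit 0 0"
  note defs = this
  \<comment> \<open>If there are indices outside \<open>B\<close>, all of them receive the maximally
    mixed state.\<close>
  define Y where "Y = (if - B = {} then {} else {C})"
  have Y: "Y = {} \<longleftrightarrow> - B = {}" "card Y \<le> card (- B)" "finite Y" "Y = {} \<or> Y = {C}"
    by (auto simp: Y_def Suc_le_eq card_gt_0_iff)
  have dens: "P \<in> density_matrices 2" "Q \<in> density_matrices 2" "R \<in> density_matrices 2" "C \<in> density_matrices 2"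
    by (auto simp: defs power2_eq_square intro!: qubit_density)
  have neq: "P \<noteq> Q" "P \<noteq> R" "Q \<noteq> R"
    by (simp_all add: defs)
  have Yd: "Y \<subseteq> density_matrices 2"
    using Y dens by auto
  \<comment> \<open>The direction (-3/5, 4/5) is a rational substitute for the optimal one, which is
    proportional to (-1, 2).\<close>
  have PQ: "47 / 25 \<le> qubit_success (Y \<union> {P, Q})"
    using qubit_success_ge[of "Y \<union> {P, Q}" 0 1 "4/5" "-3/5" "-3/5" "4/5"] dens Y(3) Yd
    by (simp add: defs power2_eq_square)
  have PR: "47 / 25 \<le> qubit_success (Y \<union> {P, R})"
    using qubit_success_ge[of "Y \<union> {P, R}" 0 1 "-4/5" "-3/5" "3/5" "4/5"] dens Y(3) Yd
    by (simp add: defs power2_eq_square)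
  have QR: "9 / 5 \<le> qubit_success (Y \<union> {Q, R})"
    using qubit_success_ge[of "Y \<union> {Q, R}" "4/5" "-3/5" "-4/5" "-3/5" 1 0] dens Y(3) Yd
    by (simp add: defs power2_eq_square)
  have PQR: "qubit_success (Y \<union> {P, Q, R}) \<le> 2"
    using qubit_success_le[of "Y \<union> {P, Q, R}" 1 0 0] dens Y(4)
    by (auto simp: defs power2_eq_square)
  have CP: "qubit_success {P, C} \<le> 3 / 2"
    using qubit_success_le[of "{P, C}" "1/2" 0 "1/2"] dens by (simp add: defs power2_eq_square)
  have CQ: "qubit_success {Q, C} \<le> 3 / 2"
    using qubit_success_le[of "{Q, C}" "1/2" "2/5" "-3/10"] dens by (simp add: defs power2_eq_square)
  have CR: "qubit_success {R, C} \<le> 3 / 2"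
    using qubit_success_le[of "{R, C}" "1/2" "-2/5" "-3/10"] dens by (simp add: defs power2_eq_square)
  have one: "qubit_success {A} = 1" if "A \<in> density_matrices 2" for A
    using that by (intro success_singleton) simp
  \<comment> \<open>Without \<open>C\<close> the left side is 3; with \<open>C\<close> it is at most
    3 * 3/2 - 1.\<close>
  have low: "qubit_success (Y \<union> {P}) + qubit_success (Y \<union> {Q}) + qubit_success (Y \<union> {R}) - qubit_success Y \<le> 7 / 2"
    using Y(4) CP CQ CR one[OF dens(1)] one[OF dens(2)] one[OF dens(3)] one[OF dens(4)]
      success_def[of mat_mix "density_matrices 2" id "{}"] by auto
  show ?thesis
  proof (rule quantum_violationI[of "{P, Q, R}" B Y])
    have "(\<Sum>S\<in>Pow {P, Q, R}. (-1) ^ card S * qubit_success (Y \<union> S)) =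
      qubit_success Y - qubit_success (Y \<union> {P}) - qubit_success (Y \<union> {Q}) - qubit_success (Y \<union> {R})
      + qubit_success (Y \<union> {P, Q}) + qubit_success (Y \<union> {P, R}) + qubit_success (Y \<union> {Q, R})
      - qubit_success (Y \<union> {P, Q, R})"
      using neq by (simp add: alternating_sum_Pow_insert)
    \<comment> \<open>The bounds leave 2 * 47/25 + 9/5 - 2 - 7/2 = 3/50.\<close>
    then show "0 < (\<Sum>S\<in>Pow {P, Q, R}. (-1) ^ card S * qubit_success (Y \<union> S))"
      using PQ PR QR PQR low by linarith
  qed (use assms dens neq Y Yd in auto)
qed

subsection \<open>Inequalities valid for all state spaces\<close>

text \<open>The value is \<open>D UNIV - D (- {i})\<close>, and a further state never lowers the
  success.\<close>

lemma c_hat_singleton_success_nonneg: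
  fixes s :: "'n::finite \<Rightarrow> 's"
  assumes "2 \<le> CARD('n)" "\<And>i. s i \<in> K"
  shows "0 \<le> c_hat {i} (success mix K s)"
proof -
  have "card (- {i}) = CARD('n) - 1"
    by (simp add: Compl_eq_Diff_UNIV)
  then have "- {i} \<noteq> {}"
    using assms(1) by auto
  moreover have "c_hat {i} D = D UNIV - D (- {i})" for D
    using alternating_sum_Pow_insert[of "{}" i "\<lambda>T. D (- {i} \<union> T)"] by (simp add: c_hat_eq Un_commute)
  ultimately show ?thesis
    using success_mono[of UNIV "- {i}" s K mix] assms(2) by simp
qed

lemma c_hat_pair:
  fixes i j :: "'n::finite"
  assumes "i \<noteq> j"
  shows "c_hat {i, j} D = D (- {j}) + D (- {i}) - D (- {i, j}) - D UNIV"
proof -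
  have "- {i, j} \<union> {i} = - {j}" "- {i, j} \<union> {j} = - {i}" "- {i, j} \<union> {i, j} = UNIV"
    using assms by auto
  then show ?thesis
    using assms by (simp add: c_hat_eq alternating_sum_Pow_insert del: Un_insert_right)
qed

text \<open>With no index outside, the value is 1 + 1 - 0 - \<open>D {i, j}\<close>.\<close>

lemma c_hat_pair_success_nonneg_2:
  fixes s :: "'n::finite \<Rightarrow> 's"
  assumes univ: "UNIV = {i, j}" and "i \<noteq> j" and s: "\<And>i. s i \<in> K"
  shows "0 \<le> c_hat {i, j} (success mix K s)"
proof -
  have "- {j} = {i}" "- {i} = {j}" "- {i, j} = {}"
    using assms(1,2) by auto
  moreover have "success mix K s {i, j} \<le> 2"
  proof (rule success_le)
    fix e assume "e \<in> measurements mix K {i, j}"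
    then have "e i (s i) \<le> 1" "e j (s j) \<le> 1"
      using s by (auto intro: measurements_le_1)
    then show "(\<Sum>i\<in>{i, j}. e i (s i)) \<le> 2"
      using \<open>i \<noteq> j\<close> by simp
  qed auto
  ultimately show ?thesis
    unfolding c_hat_pair[OF \<open>i \<noteq> j\<close>] univ
    by (simp add: s success_singleton success_def[of mix K s "{}"])
qed

text \<open>In a measurement for three states, merging outcome \<open>j\<close> into
  \<open>k\<close> serves \<open>{i, k}\<close>, and merging \<open>i\<close> into \<open>k\<close>
  serves \<open>{j, k}\<close>. Together the two score at \<open>s k\<close> the full normalization
  1 and \<open>e k\<close> once more.\<close>

lemma c_hat_pair_success_nonneg_3:
  fixes s :: "'n::finite \<Rightarrow> 's"
  assumes univ: "UNIV = {i, j, k}" and dist: "i \<noteq> j" "i \<noteq> k" "j \<noteq> k" and s: "\<And>i. s i \<in> K"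
  shows "0 \<le> c_hat {i, j} (success mix K s)"
proof -
  let ?D = "success mix K s"
  have compl: "- {j} = {i, k}" "- {i} = {j, k}" "- {i, j} = {k}"
    using univ dist by auto
  have "?D {i, j, k} \<le> ?D {i, k} + ?D {j, k} - 1"
  proof (rule success_le)
    fix e assume e: "e \<in> measurements mix K {i, j, k}"
    have sum: "e i x + e j x + e k x = 1" if "x \<in> K" for x
      using measurements_sum[OF e that] dist by (simp add: add.assoc)
    have aff: "affine_fun mix K (e i)" "affine_fun mix K (e j)" "affine_fun mix K (e k)"
      using measurements_affine[OF e] by auto
    have nonneg: "0 \<le> e i x \<and> 0 \<le> e j x \<and> 0 \<le> e k x" if "x \<in> K" for x
      using measurements_nonneg[OF e _ that] by auto
    have "e i (s i) + (e j (s k) + e k (s k)) \<le> ?D {i, k}"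
    proof -
      have "(\<lambda>l x. if l = i then e i x else e j x + e k x) \<in> measurements mix K {i, k}"
        using aff nonneg sum dist by (auto simp: measurements_def affine_fun_if affine_fun_add add.assoc)
      from success_ge[OF this, of s] show ?thesis
        using s dist by auto
    qed
    moreover have "e j (s j) + (e i (s k) + e k (s k)) \<le> ?D {j, k}"
    proof -
      have "(\<lambda>l x. if l = j then e j x else e i x + e k x) \<in> measurements mix K {j, k}"
        using aff nonneg sum dist by (auto simp: measurements_def affine_fun_if affine_fun_add algebra_simps)
      from success_ge[OF this, of s] show ?thesis
        using s dist by auto
    qed
    moreover have "(\<Sum>l\<in>{i, j, k}. e l (s l)) = e i (s i) + e j (s j) + e k (s k)"
      using dist by simp
    ultimately show "(\<Sum>l\<in>{i, j, k}. e l (s l)) \<le> ?D {i, k} + ?D {j, k} - 1"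
      using sum[OF s[of k]] by linarith
  qed auto
  then show ?thesis
    using dist s by (simp add: c_hat_pair compl univ success_singleton)
qed

lemma gpt_region_success:
  fixes F :: "real^('n::finite set)"
  assumes "F \<in> gpt_region"
  obtains K and s :: "'n \<Rightarrow> nat \<Rightarrow> real" where "\<And>i. s i \<in> K" "F = error_profile vec_mix K s"
proof -
  obtain K and s :: "'n \<Rightarrow> nat \<Rightarrow> real" where "\<forall>i. s i \<in> K" "F = error_profile vec_mix K s"
    using assms by (auto simp: gpt_region_def profiles_def)
  then show thesis
    by (intro that[of s K]) auto
qed

lemma gpt_singleton:
  fixes i :: "'n::finite"
  assumes "2 \<le> CARD('n)" "F \<in> gpt_region"
  shows "0 \<le> c_hat {i} (success_of F)"
  using assms(2)
  by (rule gpt_region_success) (simp add: success_of_error_profile c_hat_singleton_success_nonneg assms(1))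

lemma gpt_pair:
  fixes B :: "'n::finite set"
  assumes "CARD('n) \<le> 3" "card B = 2" "F \<in> gpt_region"
  shows "0 \<le> c_hat B (success_of F)"
proof -
  obtain K and s :: "'n \<Rightarrow> nat \<Rightarrow> real" where F: "\<And>i. s i \<in> K" "F = error_profile vec_mix K s"
    using gpt_region_success[OF assms(3)] by metis
  obtain i j where ij: "B = {i, j}" "i \<noteq> j"
    using assms(2) by (auto simp: card_2_iff)
  have "card (- B) = CARD('n) - 2"
    using assms(2) by (simp add: Compl_eq_Diff_UNIV card_Diff_subset)
  then have "card (- B) = 0 \<or> card (- B) = 1"
    using assms(1) by linarith
  then have "0 \<le> c_hat B (success vec_mix K s)"
  proof
    assume "card (- B) = 0"
    then have "UNIV = {i, j}"
      using ij by auto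
    then show ?thesis
      using c_hat_pair_success_nonneg_2[of i j s K vec_mix] ij F(1) by blast
  next
    assume "card (- B) = 1"
    then obtain k where k: "- B = {k}"
      by (auto simp: card_1_singleton_iff)
    then have "k \<notin> B" "UNIV = {i, j, k}"
      using ij by auto
    then show ?thesis
      using ij F(1) c_hat_pair_success_nonneg_3[of i j k s K vec_mix] by auto
  qed
  then show ?thesis
    using F by (simp add: success_of_error_profile)
qed

subsection \<open>Facets of polyhedra and inversion of \<open>c_hat\<close>\<close>

text \<open>A relative interior point of the facet saturates some constraint, which then vanishes on
  the whole facet. As the facet has codimension one, it spans \<open>V\<close> affinely together
  with \<open>x0\<close>, so agreement on these determines \<open>b - a \<bullet> v\<close> on
  \<open>V\<close>.\<close>

lemma facet_inequality_eq_constraint: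
  fixes S V :: "'v::euclidean_space set" and l :: "'i \<Rightarrow> 'v"
  assumes I: "finite I" and V: "affine V"
    and S: "S = {x\<in>V. \<forall>i\<in>I. 0 \<le> \<alpha> i + l i \<bullet> x}"
    and x0: "x0 \<in> V" "\<And>i. i \<in> I \<Longrightarrow> 0 < \<alpha> i + l i \<bullet> x0"
    and facet: "facet_inequality S a b"
  obtains i k where "i \<in> I" "0 < k" "\<And>v. v \<in> V \<Longrightarrow> b - a \<bullet> v = k * (\<alpha> i + l i \<bullet> v)"
proof -
  let ?c = "\<lambda>i x. \<alpha> i + l i \<bullet> x"
  let ?F = "S \<inter> {x. a \<bullet> x = b}"
  have valid: "\<And>x. x \<in> S \<Longrightarrow> a \<bullet> x \<le> b" and F: "?F facet_of S"
    using facet by (auto simp: facet_inequality_def)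
  have F': "?F face_of S" "?F \<noteq> {}" "aff_dim ?F = aff_dim S - 1"
    using F by (auto simp: facet_of_def)
  then have "convex ?F"
    by (simp add: face_of_imp_convex)
  \<comment> \<open>Where all constraints are strict, continuity lets the segment from
    \<open>y\<close> be prolonged a little past \<open>x\<close> inside \<open>S\<close>.\<close>
  have inner: "\<exists>e>0. (1 + e) *\<^sub>R x - e *\<^sub>R y \<in> S"
    if x: "x \<in> V" "\<And>i. i \<in> I \<Longrightarrow> 0 < ?c i x" and y: "y \<in> V" for x y
  proof -
    have "\<forall>\<^sub>F e in at_right 0. 0 \<le> ?c i ((1 + e) *\<^sub>R x - e *\<^sub>R y)" if "i \<in> I" for i
    proof -
      have "((\<lambda>e. ?c i ((1 + e) *\<^sub>R x - e *\<^sub>R y)) \<longlongrightarrow> ?c i ((1 + 0) *\<^sub>R x - 0 *\<^sub>R y)) (at_right 0)"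
        by (intro tendsto_intros)
      then have "\<forall>\<^sub>F e in at_right 0. 0 < ?c i ((1 + e) *\<^sub>R x - e *\<^sub>R y)"
        using x(2)[OF that] by (auto intro: order_tendstoD)
      then show ?thesis
        by (rule eventually_mono) simp
    qed
    then have "\<forall>\<^sub>F e in at_right 0. \<forall>i\<in>I. 0 \<le> ?c i ((1 + e) *\<^sub>R x - e *\<^sub>R y)"
      using I by (intro eventually_ball_finite) auto
    moreover have "\<forall>\<^sub>F e in at_right (0::real). 0 < e"
      by (rule eventually_at_right_less)
    ultimately have "\<forall>\<^sub>F e in at_right 0. 0 < e \<and> (\<forall>i\<in>I. 0 \<le> ?c i ((1 + e) *\<^sub>R x - e *\<^sub>R y))"
      by eventually_elim auto
    then obtain e where e: "0 < e" "\<forall>i\<in>I. 0 \<le> ?c i ((1 + e) *\<^sub>R x - e *\<^sub>R y)"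
      using eventually_happens' trivial_limit_at_right_real by blast
    have "(1 + e) *\<^sub>R x + (- e) *\<^sub>R y \<in> V"
      using V x(1) y by (intro mem_affine) auto
    then show ?thesis
      using e S by auto
  qed
  obtain x where x: "x \<in> rel_interior ?F"
    using rel_interior_eq_empty[OF \<open>convex ?F\<close>] F'(2) by blast
  then have xF: "x \<in> S" "x \<in> V" "a \<bullet> x = b"
    using rel_interior_subset[of ?F] S by auto
  have "?F \<noteq> S"
    using F'(3) by auto
  then obtain y where y: "y \<in> S" "a \<bullet> y < b"
    using valid by force
  have "\<exists>i\<in>I. ?c i x = 0"
  proof (rule ccontr)
    assume neg: "\<not> (\<exists>i\<in>I. ?c i x = 0)"
    have "0 < ?c i x" if "i \<in> I" for i
      using neg that xF(1) S by force
    then obtain e where e: "0 < e" "(1 + e) *\<^sub>R x - e *\<^sub>R y \<in> S"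
      using inner[of x y] xF y S by auto
    \<comment> \<open>Beyond \<open>x\<close>, coming from \<open>y\<close>, the functional would
      exceed \<open>b\<close>.\<close>
    have "(1 + e) * b - e * (a \<bullet> y) \<le> b"
      using valid[OF e(2)] xF by (simp add: inner_diff_right)
    then have "e * b \<le> e * (a \<bullet> y)"
      by (simp add: algebra_simps)
    then show False
      using e(1) y(2) by simp
  qed
  then obtain i where i: "i \<in> I" "?c i x = 0"
    by blast
  \<comment> \<open>The segment from \<open>w\<close> to \<open>x\<close> extends past
    \<open>x\<close> within the facet; a nonnegative affine function that is zero at
    \<open>x\<close> cannot be positive at \<open>w\<close>.\<close>
  have F0: "?c i w = 0" if w: "w \<in> ?F" for w
  proof -
    obtain e where e: "1 < e" "(1 - e) *\<^sub>R w + e *\<^sub>R x \<in> ?F"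
      using x w convex_rel_interior_iff[OF \<open>convex ?F\<close> F'(2)] by blast
    have "?c i ((1 - e) *\<^sub>R w + e *\<^sub>R x) = (1 - e) * ?c i w + e * ?c i x"
      by (simp add: inner_add_right algebra_simps)
    moreover have "0 \<le> ?c i ((1 - e) *\<^sub>R w + e *\<^sub>R x)"
      using e(2) S i(1) by blast
    ultimately have "0 \<le> (1 - e) * ?c i w"
      using i(2) by simp
    then have "?c i w \<le> 0"
      using e(1) by (simp add: zero_le_mult_iff)
    moreover have "0 \<le> ?c i w"
      using w S i(1) by blast
    ultimately show ?thesis
      by simp
  qed
  have x0S: "x0 \<in> S"
    using x0 S by (simp add: less_imp_le)
  have "x0 \<notin> affine hull ?F"
  proof
    assume "x0 \<in> affine hull ?F"
    moreover have "affine hull ?F \<subseteq> {x. l i \<bullet> x = - \<alpha> i}"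
    proof (rule hull_minimal)
      show "?F \<subseteq> {x. l i \<bullet> x = - \<alpha> i}"
        using F0 by force
    qed (rule affine_hyperplane)
    ultimately show False
      using x0(2)[OF i(1)] by auto
  qed
  then have "aff_dim (insert x0 ?F) = aff_dim S"
    using F'(3) by (simp add: aff_dim_insert)
  then have hull: "affine hull (insert x0 ?F) = affine hull S"
    using x0S by (intro aff_dim_eq_full_gen[THEN iffD1] hull_mono) auto
  \<comment> \<open>Each \<open>v\<close> lies on the line through \<open>x0\<close> and a point of
    \<open>S\<close> beyond \<open>x0\<close>.\<close>
  have VS: "V \<subseteq> affine hull S"
  proof
    fix v assume v: "v \<in> V"
    obtain e where e: "0 < e" "(1 + e) *\<^sub>R x0 - e *\<^sub>R v \<in> S"
      using inner[OF x0 v] by blast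
    let ?z = "(1 + e) *\<^sub>R x0 - e *\<^sub>R v"
    have "v = ((1 + e) / e) *\<^sub>R x0 + (- (1 / e)) *\<^sub>R ?z"
      using e(1) by (simp add: algebra_simps add_divide_distrib)
    moreover have "(1 + e) / e + (- (1 / e)) = 1"
      using e(1) by (simp add: field_simps)
    ultimately show "v \<in> affine hull S"
      using mem_affine[OF affine_affine_hull, of x0 S ?z "(1 + e) / e" "- (1 / e)"]
        hull_inc[OF x0S] hull_inc[OF e(2)] by metis
  qed
  \<comment> \<open>This factor makes the two affine functions agree at \<open>x0\<close>; on the
    facet both vanish.\<close>
  define k where "k = (b - a \<bullet> x0) / ?c i x0"
  have ci: "0 < ?c i x0"
    by (rule x0(2)[OF i(1)])
  have eq: "b - a \<bullet> v = k * ?c i v" if "v \<in> V" for v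
  proof -
    let ?H = "{v. (a + k *\<^sub>R l i) \<bullet> v = b - k * \<alpha> i}"
    have "k * ?c i x0 = b - a \<bullet> x0"
      using ci by (simp add: k_def)
    then have "x0 \<in> ?H"
      by (simp add: inner_add_left algebra_simps)
    moreover have "w \<in> ?H" if "w \<in> ?F" for w
    proof -
      have "k * ?c i w = 0"
        using F0[OF that] by simp
      then show ?thesis
        using that by (simp add: inner_add_left algebra_simps)
    qed
    ultimately have "affine hull (insert x0 ?F) \<subseteq> ?H"
      by (intro hull_minimal affine_hyperplane) blast
    then have "v \<in> ?H"
      using hull VS that by blast
    then show ?thesis
      by (simp add: inner_add_left algebra_simps)
  qed
  have "0 \<le> k"
    using valid[OF x0S] ci by (simp add: k_def)
  moreover have "k \<noteq> 0"
    using eq[of y] y S by auto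
  ultimately show thesis
    using that[of i k] i(1) eq by simp
qed

text \<open>Up to sign \<open>c_hat\<close> is the Moebius transform of
  \<open>A \<mapsto> D (- A)\<close> on the lattice of subsets, so summation over subsets inverts
  it.\<close>

lemma sum_Pow_c_hat:
  fixes D :: "'n::finite set \<Rightarrow> real"
  shows "(\<Sum>B\<in>Pow A. c_hat B D) = - D (- A)"
proof -
  define f where "f T = (-1) ^ card T * D (- T)" for T :: "'n set"
  define g where "g B = (\<Sum>T\<in>Pow B. (-1) ^ card T * D (- T))" for B :: "'n set"
  have c: "c_hat B D = - ((-1) ^ card B * g B)" for B
  proof -
    have "(-1) ^ (card B - card T) = ((-1) ^ card B * (-1) ^ card T :: real)" if "T \<in> Pow B" for T
    proof -
      have "card T \<le> card B"
        using that by (simp add: card_mono)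
      then show ?thesis
        by (simp add: minus_one_power_iff)
    qed
    then show ?thesis
      by (simp add: c_hat_def g_def sum_distrib_left mult.assoc)
  qed
  have "D (- A) = (\<Sum>T\<in>Pow A. (-1) ^ card T * g T)"
    using inclusion_exclusion_symmetric[of g "\<lambda>T. D (- T)" A] by (simp add: g_def)
  then show ?thesis
    by (simp add: c sum_negf)
qed

text \<open>
  \<open>c_hat B\<close> is the weight of \<open>B\<close> when \<open>D H\<close> is written as the total weight of the sets
  that meet \<open>H\<close>.
\<close>

lemma eq_sum_c_hat:
  fixes D :: "'n::finite set \<Rightarrow> real"
  assumes "D {} = 0"
  shows "D H = (\<Sum>B | B \<inter> H \<noteq> {}. c_hat B D)"
proof -
  have "{B. B \<inter> H \<noteq> {}} = Pow UNIV - Pow (- H)"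
    by auto
  then have "(\<Sum>B | B \<inter> H \<noteq> {}. c_hat B D) = (\<Sum>B\<in>Pow UNIV. c_hat B D) - (\<Sum>B\<in>Pow (- H). c_hat B D)"
    by (simp add: sum_diff)
  then show ?thesis
    using assms by (simp only: sum_Pow_c_hat) simp
qed

text \<open>The maximum-minimums identity with a floor \<open>c\<close> under every maximum. Adding
  \<open>x\<close> to \<open>T\<close> raises the floor to \<open>max c (v x)\<close>, which is why
  \<open>c\<close> varies in the induction.\<close>

lemma alternating_sum_Max_le:
  fixes v :: "'n \<Rightarrow> real"
  assumes "finite B" "B \<noteq> {}"
  shows "(\<Sum>T\<in>Pow B. (-1) ^ card T * Max (insert c (v ` T))) = c - max c (Min (v ` B))"
  using assms
proof (induction B arbitrary: c rule: finite_ne_induct)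
  case (singleton x)
  have "Pow {x} = {{}, {x}}" by auto
  then show ?case by simp
next
  case (insert x B)
  have "Max (insert c (v ` insert x T)) = Max (insert (max c (v x)) (v ` T))" if "T \<in> Pow B" for T
  proof -
    have "finite T"
      using that insert.hyps finite_subset by auto
    then show ?thesis
      by (cases "T = {}") (simp_all add: max.assoc)
  qed
  then have "(\<Sum>T\<in>Pow (insert x B). (-1) ^ card T * Max (insert c (v ` T))) =
    (\<Sum>T\<in>Pow B. (-1) ^ card T * (Max (insert c (v ` T)) - Max (insert (max c (v x)) (v ` T))))"
    using insert.hyps by (subst alternating_sum_Pow_insert) (auto intro!: sum.cong)
  also have "\<dots> = (c - max c (Min (v ` B))) - (max c (v x) - max (max c (v x)) (Min (v ` B)))"
    using insert.IH[of c] insert.IH[of "max c (v x)"] by (simp add: right_diff_distrib sum_subtractf)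
  also have "\<dots> = c - max c (Min (v ` insert x B))"
  proof -
    obtain m where m: "m = Min (v ` B)" by simp
    then have "Min (v ` insert x B) = min (v x) m"
      using insert.hyps by simp
    then show ?thesis
      unfolding m[symmetric] by (simp add: max_def min_def)
  qed
  finally show ?case .
qed

text \<open>The values outside \<open>B\<close>, together with 0, supply the floor \<open>c\<close>
  of the preceding identity, so the value is \<open>max c m - c\<close> with \<open>m\<close> the
  minimum of \<open>v\<close> on \<open>B\<close>.\<close>

lemma c_hat_Max_nonneg:
  fixes v :: "'n::finite \<Rightarrow> real"
  assumes "B \<noteq> {}"
  shows "0 \<le> c_hat B (\<lambda>H. Max (insert 0 (v ` H)))"
proof -
  have "Max (insert 0 (v ` (- B \<union> T))) = Max (insert (Max (insert 0 (v ` (- B)))) (v ` T))" for T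
  proof -
    have "insert 0 (v ` (- B \<union> T)) = insert 0 (v ` (- B)) \<union> v ` T"
      by auto
    then show ?thesis
      by (cases "T = {}") (simp_all only: Max_Un Max_insert finite finite_insert finite_imageI image_is_empty insert_not_empty not_False_eq_True Un_empty_right image_empty Max_singleton)
  qed
  then show ?thesis
    using alternating_sum_Max_le[of B "Max (insert 0 (v ` (- B)))" v] assms by (simp add: c_hat_eq)
qed

lemma c_hat_sum:
  "c_hat B (\<lambda>H. \<Sum>j\<in>J. f j H) = (\<Sum>j\<in>J. c_hat B (f j))"
  unfolding c_hat_def sum_distrib_left sum_negf by (subst sum.swap) simp

subsection \<open>The classical region\<close>

text \<open>Maximum likelihood is optimal: on seeing \<open>j\<close>, guess an index whose state
  gives \<open>j\<close> the largest mass. The dual certificate is the vector of maxima divided by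
  its total \<open>c\<close>.\<close>

lemma success_prob_simplex:
  assumes "finite H" and s: "\<And>i. i \<in> H \<Longrightarrow> s i \<in> prob_simplex m"
  shows "success vec_mix (prob_simplex m) s H = (\<Sum>j<m. Max (insert 0 ((\<lambda>i. s i j) ` H)))"
proof (cases "H = {}")
  case True
  then show ?thesis by (simp add: success_def)
next
  case False
  define M where "M j = Max (insert 0 ((\<lambda>i. s i j) ` H))" for j
  define c where "c = (\<Sum>j<m. M j)"
  have s': "0 \<le> s i j" "j \<ge> m \<Longrightarrow> s i j = 0" "(\<Sum>j<m. s i j) = 1" if "i \<in> H" for i j
    using s[OF that] by (auto simp: prob_simplex_def)
  have M: "s i j \<le> M j" "0 \<le> M j" if "i \<in> H" for i j
    using assms(1) that by (auto simp: M_def)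
  have M0: "0 \<le> M j" for j
    using M False by blast
  have Mm: "M j = 0" if "m \<le> j" for j
  proof -
    have "(\<lambda>i. s i j) ` H = {0}"
      using s'(2) that False by auto
    then show ?thesis
      by (simp add: M_def)
  qed
  obtain i0 where "i0 \<in> H"
    using False by blast
  then have c1: "1 \<le> c"
    using sum_mono[of "{..<m}" "s i0" M] M(1) s'(3) by (simp add: c_def)
  have "success vec_mix (prob_simplex m) s H \<le> c"
  proof (rule success_le_dual[where \<sigma> = "\<lambda>j. M j / c"])
    show "(\<lambda>j. M j / c) \<in> prob_simplex m"
      using M0 Mm c1 by (auto simp: prob_simplex_def c_def simp flip: sum_divide_distrib)
  next
    fix i assume i: "i \<in> H"
    have diff: "(\<Sum>j<m. M j - s i j) = c - 1"
      using s'(3)[OF i] by (simp add: c_def sum_subtractf)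
    show "\<exists>\<tau>\<in>prob_simplex m. vec_mix (1 / c) \<tau> (s i) = (\<lambda>j. M j / c)"
    \<comment> \<open>If \<open>c = 1\<close>, the state equals \<open>M\<close> and
      \<open>\<tau>\<close> has weight 0; otherwise \<open>\<tau>\<close> is the excess
      \<open>M - s i\<close>, of total \<open>c - 1\<close>, normalized.\<close>
    proof (cases "c = 1")
      case True
      have "M j = s i j" for j
      proof (cases "j < m")
        case True
        have "\<forall>j\<in>{..<m}. M j - s i j = 0"
          using diff \<open>c = 1\<close> M(1)[OF i] by (subst sum_nonneg_eq_0_iff[symmetric]) auto
        then show ?thesis
          using True by simp
      qed (use Mm s'(2)[OF i] in auto)
      then have "vec_mix (1 / c) (s i) (s i) = (\<lambda>j. M j / c)"
        using True by (simp add: vec_mix_def)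
      then show ?thesis
        using s[OF i] by blast
    next
      case False
      then have c: "c > 1"
        using c1 by simp
      let ?t = "\<lambda>j. (M j - s i j) / (c - 1)"
      have "?t \<in> prob_simplex m"
        using diff c M(1)[OF i] Mm s'(2)[OF i]
        by (auto simp: prob_simplex_def simp flip: sum_divide_distrib)
      moreover have "vec_mix (1 / c) ?t (s i) = (\<lambda>j. M j / c)"
      proof
        fix j
        have "1 - 1 / c = (c - 1) / c"
          using c by (simp add: field_simps)
        then have "(1 - 1 / c) * ?t j = (M j - s i j) / c"
          using c by simp
        then show "vec_mix (1 / c) ?t (s i) j = M j / c"
          unfolding vec_mix_def by (simp add: diff_divide_distrib)
      qed
      ultimately show ?thesis
        by blast
    qed
  qed (use assms False c1 in auto)
  moreover have "c \<le> success vec_mix (prob_simplex m) s H"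
  proof -
    have "\<exists>i\<in>H. s i j = M j" for j
    proof -
      have "M j \<in> insert 0 ((\<lambda>i. s i j) ` H)"
        unfolding M_def using assms(1) by (intro Max_in) auto
      \<comment> \<open>The inserted 0 is attained as well when it is the maximum.\<close>
      moreover have "s i0 j = M j" if "M j = 0"
        using M(1)[OF \<open>i0 \<in> H\<close>, of j] s'(1)[OF \<open>i0 \<in> H\<close>, of j] that by simp
      ultimately show ?thesis
        using \<open>i0 \<in> H\<close> by auto
    qed
    then obtain k where k: "\<And>j. k j \<in> H" "\<And>j. s (k j) j = M j"
      by metis
    let ?e = "\<lambda>i p. \<Sum>j\<in>{j\<in>{..<m}. k j = i}. p j"
    have group: "(\<Sum>i\<in>H. ?e i p) = (\<Sum>j<m. p j)" for p :: "nat \<Rightarrow> real"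
      using assms(1) k(1) by (intro sum.group) auto
    have "affine_fun vec_mix (prob_simplex m) (\<lambda>p. p j)" for j
      by (simp add: affine_fun_def vec_mix_def)
    then have "?e \<in> measurements vec_mix (prob_simplex m) H"
      using group by (auto simp: measurements_def prob_simplex_def intro!: affine_fun_sum sum_nonneg)
    then have "(\<Sum>i\<in>H. ?e i (s i)) \<le> success vec_mix (prob_simplex m) s H"
      using assms False by (intro success_ge)
    moreover have "(\<Sum>i\<in>H. ?e i (s i)) = (\<Sum>i\<in>H. ?e i (\<lambda>j. s (k j) j))"
      by (intro sum.cong) auto
    ultimately show ?thesis
      using group[of "\<lambda>j. s (k j) j"] k(2) by (simp add: c_def)
  qed
  ultimately show ?thesis
    by (simp add: c_def M_def)
qed

definition profile_space :: "(real^('n::finite set)) set" where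
  "profile_space = {F. \<forall>H. card H < 2 \<longrightarrow> F $ H = 0}"

lemma error_profile_in_profile_space: "error_profile mix K s \<in> profile_space"
  by (simp add: profile_space_def error_profile_def)

lemma affine_profile_space: "affine profile_space"
  by (simp add: affine_def profile_space_def)

text \<open>To realize a point of the polytope, take one outcome per subset \<open>B\<close>, to
  which \<open>s i\<close> gives mass \<open>c_hat B D\<close> if \<open>i \<in> B\<close> and 0
  otherwise. The largest mass over \<open>H\<close> is then \<open>c_hat B D\<close> or 0 according
  to whether \<open>B\<close> meets \<open>H\<close>, and the sum of these is
  \<open>D H\<close>.\<close>

lemma classical_region_eq:
  "classical_region = {F \<in> profile_space. \<forall>B\<in>- {{}}. 0 \<le> c_hat B (success_of (F :: real^('n::finite set)))}"
    (is "_ = ?P")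
proof
  show "classical_region \<subseteq> ?P"
  proof
    fix F :: "real^('n set)"
    assume "F \<in> classical_region"
    then obtain m and s :: "'n \<Rightarrow> nat \<Rightarrow> real" where
        F: "F = error_profile vec_mix (prob_simplex m) s" and s: "\<forall>i. s i \<in> prob_simplex m"
      by (auto simp: classical_region_def profiles_def)
    have "success_of F = (\<lambda>H. \<Sum>j<m. Max (insert 0 ((\<lambda>i. s i j) ` H)))"
      using s by (simp add: F success_of_error_profile success_prob_simplex fun_eq_iff)
    then show "F \<in> ?P"
      by (auto simp: c_hat_sum F error_profile_in_profile_space intro!: sum_nonneg c_hat_Max_nonneg)
  qed
next
  show "?P \<subseteq> classical_region"
  proof
    fix F :: "real^('n set)"
    assume "F \<in> ?P"
    then have V: "\<And>H. card H < 2 \<Longrightarrow> F $ H = 0"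
      and pos: "\<And>B. B \<noteq> {} \<Longrightarrow> 0 \<le> c_hat B (success_of F)"
      by (auto simp: profile_space_def)
    define w where "w B = c_hat B (success_of F)" for B :: "'n set"
    have D: "success_of F H = (\<Sum>B | B \<inter> H \<noteq> {}. w B)" for H
      unfolding w_def using V[of "{}"] by (intro eq_sum_c_hat) (simp add: success_of_def)
    define m where "m = CARD('n set)"
    obtain h :: "nat \<Rightarrow> 'n set" where h: "bij_betw h {..<m} UNIV"
      using ex_bij_betw_nat_finite[of "UNIV :: 'n set set"] by (auto simp: m_def atLeast0LessThan)
    have reindex: "(\<Sum>j<m. f (h j)) = (\<Sum>B\<in>UNIV. f B)" for f :: "'n set \<Rightarrow> real"
      using h by (rule sum.reindex_bij_betw)
    define s where "s i j = (if j < m \<and> i \<in> h j then w (h j) else 0)" for i j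
    have s: "s i \<in> prob_simplex m" for i
    proof -
      have "(\<Sum>j<m. s i j) = (\<Sum>j<m. if i \<in> h j then w (h j) else 0)"
        by (intro sum.cong) (simp_all add: s_def)
      also have "\<dots> = (\<Sum>B\<in>UNIV. if i \<in> B then w B else 0)"
        by (rule reindex)
      \<comment> \<open>The total mass is \<open>D {i}\<close>, which is 1 because \<open>F\<close>
        vanishes on singletons.\<close>
      also have "\<dots> = success_of F {i}"
        by (simp add: D sum.If_cases)
      also have "\<dots> = 1"
        using V[of "{i}"] by (simp add: success_of_def)
      finally show ?thesis
        using pos by (auto simp: prob_simplex_def s_def w_def)
    qed
    have "success vec_mix (prob_simplex m) s H = success_of F H" for H
    proof -
      have "Max (insert 0 ((\<lambda>i. s i j) ` H)) = (if h j \<inter> H \<noteq> {} then w (h j) else 0)" if "j < m" for j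
      proof (cases "h j \<inter> H = {}")
        case True
        then have "insert 0 ((\<lambda>i. s i j) ` H) = {0}"
          by (auto simp: s_def)
        from arg_cong[OF this, of Max] show ?thesis
          using True by simp
      next
        case False
        then have "0 \<le> w (h j)"
          unfolding w_def by (intro pos) auto
        moreover have "insert 0 ((\<lambda>i. s i j) ` H) \<subseteq> {0, w (h j)}" "w (h j) \<in> insert 0 ((\<lambda>i. s i j) ` H)"
          using False that by (auto simp: s_def)
        ultimately show ?thesis
          using False by (intro Max_eqI) auto
      qed
      then have "success vec_mix (prob_simplex m) s H = (\<Sum>j<m. if h j \<inter> H \<noteq> {} then w (h j) else 0)"
        using s by (simp add: success_prob_simplex)
      also have "\<dots> = success_of F H"
        by (simp add: reindex[of "\<lambda>B. if B \<inter> H \<noteq> {} then w B else 0"] D sum.If_cases)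
      finally show ?thesis .
    qed
    then have "F = error_profile vec_mix (prob_simplex m) s"
      using V by (simp add: Finite_Cartesian_Product.vec_eq_iff error_profile_def success_of_def not_less[symmetric])
    moreover have "1 \<le> m"
      by (simp add: m_def Suc_le_eq)
    ultimately show "F \<in> classical_region"
      using s unfolding classical_region_def profiles_def by auto
  qed
qed

section \<open>Facet inequalities of the classical region\<close>

lemma c_hat_success_of_affine:
  "c_hat B (success_of F) = c_hat B (\<lambda>H. real (card H)) +
    (\<Sum>A\<in>Pow B. (-1) ^ (card B - card A) *\<^sub>R axis (- A) 1) \<bullet> F"
  by (simp add: c_hat_def success_of_def inner_sum_left inner_axis' right_diff_distrib sum_subtractf)

lemma sum_Pow_power_card:
  fixes x :: real
  assumes "finite B"
  shows "(\<Sum>T\<in>Pow B. x ^ card T) = (1 + x) ^ card B"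
  using assms
proof (induction B rule: finite_induct)
  case (insert b B)
  have "x ^ card (insert b T) = x * x ^ card T" if "T \<in> Pow B" for T
    using that insert.hyps finite_subset[of T B] by (subst card_insert_disjoint) auto
  then show ?case
    using insert by (simp add: sum_Pow_insert algebra_simps flip: sum_distrib_left)
qed simp

lemma classical_interior_point:
  obtains F :: "real^('n::finite set)"
  where "F \<in> profile_space" "\<And>B. B \<noteq> {} \<Longrightarrow> 0 < c_hat B (success_of F)"
proof
  \<comment> \<open>Equal weights 2^(1-n) on all nonempty sets: those meeting \<open>H\<close> weigh
    2^(1-n) * (2^n - 2^(n-|H|)) in total.\<close>
  define D :: "'n set \<Rightarrow> real" where "D H = 2 - 2 * (1 / 2) ^ card H" for H
  define F :: "real^('n set)" where "F = (\<chi> H. real (card H) - D H)"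
  show "F \<in> profile_space"
  proof -
    have "F $ H = 0" if "card H < 2" for H
    proof -
      have "card H = 0 \<or> card H = 1"
        using that by linarith
      then show ?thesis
        by (auto simp: F_def D_def)
    qed
    then show ?thesis
      by (simp add: profile_space_def)
  qed
  show "0 < c_hat B (success_of F)" if "B \<noteq> {}" for B
  proof -
    have "success_of F = D"
      by (simp add: fun_eq_iff success_of_def F_def)
    moreover have "(-1) ^ card T * D (- B \<union> T) =
        2 * (-1) ^ card T - 2 * (1 / 2) ^ card (- B) * (- 1 / 2) ^ card T" if "T \<in> Pow B" for T
    proof -
      have "card (- B \<union> T) = card (- B) + card T"
        using that by (intro card_Un_disjoint) auto
      moreover have "(- 1 / 2 :: real) ^ card T = (-1) ^ card T * (1 / 2) ^ card T"
        by (simp flip: power_mult_distrib)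
      ultimately show ?thesis
        by (simp add: D_def power_add algebra_simps)
    qed
    ultimately have "c_hat B (success_of F) =
        - (\<Sum>T\<in>Pow B. 2 * (-1) ^ card T - 2 * (1 / 2) ^ card (- B) * (- 1 / 2) ^ card T)"
      by (simp add: c_hat_eq)
    also have "\<dots> = 2 * (1 / 2) ^ card (- B) * (1 - 1 / 2) ^ card B - 2 * (1 + (- 1)) ^ card B"
      unfolding sum_subtractf sum_distrib_left[symmetric]
      by (simp add: sum_Pow_power_card)
    also have "\<dots> > 0"
      using that by (simp add: zero_power card_gt_0_iff)
    finally show ?thesis .
  qed
qed

text \<open>The identity is confined to \<open>profile_space\<close> since \<open>a\<close> may have
  any components along the coordinates of the empty set and the singletons.\<close>

lemma classical_facet:
  fixes a :: "real^('n::finite set)"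
  assumes "facet_inequality classical_region a b"
  obtains B k where "B \<noteq> {}" "0 < k"
    "\<And>F. F \<in> profile_space \<Longrightarrow> b - a \<bullet> F = k * c_hat B (success_of F)"
proof -
  obtain F0 :: "real^('n set)" where F0: "F0 \<in> profile_space" "\<And>B. B \<noteq> {} \<Longrightarrow> 0 < c_hat B (success_of F0)"
    by (rule classical_interior_point) blast
  let ?l = "\<lambda>B. \<Sum>A\<in>Pow B. (-1) ^ (card B - card A) *\<^sub>R axis (- A) (1::real)"
  obtain B k where "B \<in> - {{}}" "0 < k"
    "\<And>F. F \<in> profile_space \<Longrightarrow> b - a \<bullet> F = k * (c_hat B (\<lambda>H. real (card H)) + ?l B \<bullet> F)"
  proof (rule facet_inequality_eq_constraint[OF _ affine_profile_space _ _ _ assms,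
        where I = "- {{}}" and \<alpha> = "\<lambda>B. c_hat B (\<lambda>H. real (card H))" and l = ?l and ?x0.0 = F0])
    show "classical_region = {x \<in> profile_space. \<forall>B\<in>- {{}}. 0 \<le> c_hat B (\<lambda>H. real (card H)) + ?l B \<bullet> x}"
      by (simp only: classical_region_eq c_hat_success_of_affine)
    show "0 < c_hat B (\<lambda>H. real (card H)) + ?l B \<bullet> F0" if "B \<in> - {{}}" for B
      using F0(2)[of B] that by (simp add: c_hat_success_of_affine)
  qed (use F0(1) in auto)
  then show thesis
    by (intro that[of B k]) (auto simp: c_hat_success_of_affine)
qed

theorem theorem7p1:
  assumes "CARD('n::finite) \<ge> 2"
  shows
    "(\<forall>(a :: real^('n set)) b.
        facet_inequality classical_region a b \<longrightarrow>
        (\<exists>F\<in>gpt_region. a \<bullet> F > b) \<longrightarrow>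
        (\<exists>F\<in>quantum_region {1..3}. a \<bullet> F > b))
     \<and> (CARD('n) \<ge> 4 \<longrightarrow>
          (\<forall>i::'n. \<forall>F\<in>gpt_region. c_hat {i} (success_of F) \<ge> 0) \<and>
          (\<forall>B::'n set. card B \<ge> 2 \<longrightarrow>
             (\<exists>F\<in>quantum_region {1..3}. c_hat B (success_of F) < 0)))
     \<and> (CARD('n) = 3 \<longrightarrow>
          (\<forall>B::'n set. card B \<in> {1, 2} \<longrightarrow>
             (\<forall>F\<in>gpt_region. c_hat B (success_of F) \<ge> 0)) \<and>
          (\<exists>F\<in>quantum_region {1..3}. c_hat (UNIV :: 'n set) (success_of F) < 0))"
proof -
  have singleton: "0 \<le> c_hat B (success_of F)" if "card B = 1" "F \<in> gpt_region"
    for B :: "'n set" and F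
    using that gpt_singleton[OF assms] by (auto simp: card_1_singleton_iff)
  have quantum: "\<exists>F\<in>quantum_region {1..3}. c_hat B (success_of F) < 0"
    if "4 \<le> CARD('n)" "2 \<le> card B" for B :: "'n set"
  proof (cases "3 \<le> card B")
    case False
    have "card (- B) = CARD('n) - card B"
      by (simp add: Compl_eq_Diff_UNIV card_Diff_subset)
    then have "2 \<le> card (- B)"
      using that False by linarith
    then show ?thesis
      using quantum_violation_pairs that(2) by blast
  qed (rule quantum_violation_triple)
  have facet: "\<exists>F\<in>quantum_region {1..3}. a \<bullet> F > b"
    if facet: "facet_inequality classical_region a b" and G: "G \<in> gpt_region" "a \<bullet> G > b"
    for a G :: "real^('n set)" and b
  proof -
    obtain B k where B: "B \<noteq> {}" "0 < k"
        "\<And>F. F \<in> profile_space \<Longrightarrow> b - a \<bullet> F = k * c_hat B (success_of F)"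
      using classical_facet[OF facet] by metis
    have "G \<in> profile_space"
      using G(1) by (auto simp: gpt_region_def profiles_def error_profile_in_profile_space)
    then have "k * c_hat B (success_of G) < 0"
      using B(3)[of G] G(2) by simp
    then have neg: "c_hat B (success_of G) < 0"
      using B(2) by (simp add: mult_less_0_iff)
    have card: "1 \<le> card B"
      using B(1) by (simp add: Suc_le_eq card_gt_0_iff)
    have "card B \<noteq> 1"
      using singleton[of B G] G(1) neg by auto
    moreover have "\<not> (card B = 2 \<and> CARD('n) \<le> 3)"
      using gpt_pair[of B G] G(1) neg by auto
    \<comment> \<open>The remaining sets all have a qubit violation; for \<open>n = 2\<close> none
      remain.\<close>
    ultimately have "3 \<le> card B \<or> (4 \<le> CARD('n) \<and> 2 \<le> card B)"
      using card by linarith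
    then obtain F where F: "F \<in> quantum_region {1..3}" "c_hat B (success_of F) < 0"
      using quantum quantum_violation_triple by blast
    have "F \<in> profile_space"
      using F(1) by (auto simp: quantum_region_def profiles_def error_profile_in_profile_space)
    then have "b - a \<bullet> F < 0"
      using B(2,3) F(2) by (simp add: mult_pos_neg)
    then show ?thesis
      using F(1) by auto
  qed
  have three: "\<exists>F\<in>quantum_region {1..3}. c_hat (UNIV :: 'n set) (success_of F) < 0" if "CARD('n) = 3"
    using that by (intro quantum_violation_triple) simp
  have pair: "0 \<le> c_hat B (success_of F)" if "CARD('n) = 3" "card B = 2" "F \<in> gpt_region"
    for B :: "'n set" and F
    using that by (intro gpt_pair) simp_all
  show ?thesis
    using facet gpt_singleton[OF assms] quantum singleton pair three by auto
qed

end
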